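(* If $k \geq 2$ and $k$ divides $l$, then \[ ex(n;P_l;k) \geq n^{(l/k)+1} + O(n^{1+\frac{l-1}{k}}). \] In particular, if $l$ is even then $ex(n;P_l;2) \geq n^{(l/2)+1} + O(n^{(l+1)/2})$. If $l$ is odd, then $ex(n;P_l;2) \geq (n/2)^{(l+3)/2}$.
   Context: A digraph has a vertex set and an arc set consisting of ordered pairs of distinct vertices. A walk of length $\ell$ is a sequence $x_0x_1\dots x_\ell$ of vertices with $x_i \rightarrow x_{i+1}$ for all $i$. A digraph is $k$-geodetic if for every ordered pair $(u,v)$ of (not necessarily distinct) vertices there is at most one $u,v$-walk of length at most $k$. $P_l$ denotes the directed path of length $l$ (with $l$ arcs and $l+1$ distinct vertices). For a digraph $Z$ and $k\ge 2$, $ex(n;Z;k)$ is the largest number of copies of $Z$ (subdigraphs isomorphic to $Z$) in a $k$-geodetic digraph with $n$ vertices.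
   Formalization: For odd l the bound is proved as (n/2)^{(l+3)/2} + O(n^{(l+1)/2}): without an error term it is false, e.g. for 1 ≤ n ≤ l there are no copies of P_l, and for l = 1 it fails for odd n. *)

theory Defs
  imports
    Complex_Main
    "HOL-Library.Landau_Symbols"
    "Graph_Theory.Pair_Digraph"
    "Graph_Theory.Vertex_Walk"
    "Graph_Theory.Digraph_Component"
    "Graph_Theory.Digraph_Isomorphism"
begin

definition k_geodetic :: "nat \<Rightarrow> 'a pair_pre_digraph \<Rightarrow> bool" where
  "k_geodetic k G \<longleftrightarrow>
     (\<forall>u \<in> pverts G. \<forall>v \<in> pverts G. \<forall>p q.
        vwalk p (with_proj G) \<and> hd p = u \<and> last p = v \<and> vwalk_length p \<le> k \<and>
        vwalk q (with_proj G) \<and> hd q = u \<and> last q = v \<and> vwalk_length q \<le> k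
        \<longrightarrow> p = q)"

definition dipath :: "nat \<Rightarrow> nat pair_pre_digraph" where
  "dipath l = \<lparr> pverts = {0..l}, parcs = {(i, Suc i) |i. i < l} \<rparr>"

text \<open>A copy is a subdigraph, that is, a vertex set together with an arc set; different
  isomorphisms onto the same subdigraph are not counted separately.\<close>

definition copies :: "'b pair_pre_digraph \<Rightarrow> 'a pair_pre_digraph \<Rightarrow> 'a pair_pre_digraph set" where
  "copies Z G = {H. subgraph (with_proj H) (with_proj G) \<and>
                    digraph_iso (with_proj Z) (with_proj H)}"

text \<open>Taking the vertices from \<^typ>\<open>nat\<close> loses nothing: every finite digraph is isomorphic to one
  with vertices in \<^typ>\<open>nat\<close>, and the number of copies is invariant under isomorphism.
  The lemmas after the definition show that the maximum is over a finite nonempty set.\<close>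

definition copy_counts :: "nat \<Rightarrow> 'b pair_pre_digraph \<Rightarrow> nat \<Rightarrow> nat set" where
  "copy_counts n Z k =
     {card (copies Z G) |G :: nat pair_pre_digraph.
        pair_digraph G \<and> card (pverts G) = n \<and> k_geodetic k G}"

definition ex :: "nat \<Rightarrow> 'b pair_pre_digraph \<Rightarrow> nat \<Rightarrow> nat" where
  "ex n Z k = Max (copy_counts n Z k)"

lemma copies_bounded:
  fixes G :: "'a pair_pre_digraph"
  assumes "pair_digraph G"
  shows "finite (copies Z G)"
    and "card (copies Z G) \<le> 2 ^ card (pverts G) * 2 ^ (card (pverts G))\<^sup>2"
proof -
  interpret pair_digraph G by fact
  let ?V = "pverts G"
  let ?S = "Pow ?V \<times> Pow (?V \<times> ?V)"
  let ?f = "\<lambda>H :: 'a pair_pre_digraph. (pverts H, parcs H)"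
  have fin: "finite ?S" using pair_finite_verts by simp
  have sub: "?f ` copies Z G \<subseteq> ?S"
  proof
    fix x assume "x \<in> ?f ` copies Z G"
    then obtain H where x: "x = ?f H" and H: "pverts H \<subseteq> ?V" "parcs H \<subseteq> parcs G"
      by (auto simp: copies_def subgraph_def)
    moreover have "parcs G \<subseteq> ?V \<times> ?V"
      by (auto dest: in_arcsD1 in_arcsD2)
    ultimately show "x \<in> ?S" by blast
  qed
  have inj: "inj_on ?f (copies Z G)"
    by (auto intro: inj_onI)
  show "finite (copies Z G)"
    using finite_subset[OF sub fin] inj by (rule finite_imageD)
  have "card (copies Z G) \<le> card ?S"
    by (rule card_inj_on_le[OF inj sub fin])
  also have "\<dots> = 2 ^ card ?V * 2 ^ (card ?V)\<^sup>2"
    using pair_finite_verts by (simp add: card_cartesian_product card_Pow power2_eq_square)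
  finally show "card (copies Z G) \<le> 2 ^ card ?V * 2 ^ (card ?V)\<^sup>2" .
qed

lemma finite_copy_counts: "finite (copy_counts n Z k)"
  by (rule finite_subset[of _ "{..2 ^ n * 2 ^ n\<^sup>2}"])
     (auto simp: copy_counts_def dest: copies_bounded(2))

lemma copy_counts_nonempty: "copy_counts n Z k \<noteq> {}"
proof -
  let ?G = "\<lparr> pverts = {..<n}, parcs = {} \<rparr> :: nat pair_pre_digraph"
  have triv: "p = [hd p]" if "vwalk p (with_proj ?G)" for p
    using that by (cases p rule: vwalk_arcs.cases) (auto simp: vwalk_def)
  have "k_geodetic k ?G"
    unfolding k_geodetic_def by (metis triv)
  moreover have "pair_digraph ?G" by unfold_locales auto
  ultimately show ?thesis unfolding copy_counts_def by force
qed

end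

theory Submission
  imports Defs
begin

text \<open>
  If \<open>k\<close> divides \<open>l\<close>, take the permutation digraph: its vertices are the words of \<open>k\<close> distinct letters
  from an alphabet of size \<open>N = \<lfloor>n powr (1/k)\<rfloor>\<close>, and an arc deletes the first letter and appends a
  letter not occurring in the word. A walk of at most \<open>k\<close> arcs is determined by its ends: the position of
  the first letter of the final word in the initial word gives the length, and every letter on the
  way belongs to one of the two words. Every word of \<open>k + l\<close> distinct letters traces a
  different path of length \<open>l\<close>, so there are at least \<open>(N - (k + l)) ^ (k + l)\<close> of them.

  If \<open>l = 2 t + 1\<close> and \<open>k = 2\<close>, take two copies of \<open>{..<m}\<close> with \<open>m = n div 2\<close>, all arcs \<open>a \<rightarrow> b'\<close>
  with \<open>a \<noteq> b\<close>, and the matching \<open>b' \<rightarrow> b\<close>. Only every other step of a path involves a choice, but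
  that choice is among almost all \<open>m\<close> values, so words of \<open>t + 2\<close> distinct letters give paths
  \<open>a\<^sub>0 a\<^sub>1' a\<^sub>1 a\<^sub>2' a\<^sub>2 \<dots> a'\<close> of length \<open>l\<close>. In both cases Bernoulli's inequality bounds the error term.
\<close>

section \<open>Paths as images of vertex sequences\<close>

definition dipath_image :: "nat \<Rightarrow> (nat \<Rightarrow> 'a) \<Rightarrow> 'a pair_pre_digraph" where
  "dipath_image l v = \<lparr> pverts = v ` {0..l}, parcs = (\<lambda>i. (v i, v (Suc i))) ` {..<l} \<rparr>"

lemma pair_wf_dipath_image: "pair_wf_digraph (dipath_image l v)"
  by unfold_locales (auto simp: dipath_image_def)

lemma dipath_eq_image: "dipath l = dipath_image l id"
  by (auto simp: dipath_def dipath_image_def)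

lemma digraph_iso_dipath_image:
  assumes "inj_on v {0..l}"
  shows "digraph_iso (with_proj (dipath l)) (with_proj (dipath_image l v))"
proof -
  let ?f = "\<lparr> iso_verts = v, iso_arcs = map_prod v v, iso_head = snd, iso_tail = fst \<rparr>"
  have sub: "parcs (dipath l) \<subseteq> {0..l} \<times> {0..l}"
    by (auto simp: dipath_def)
  have "inj_on (map_prod v v) (parcs (dipath l))"
    using map_prod_inj_on[OF assms assms] sub by (rule inj_on_subset)
  then have "pre_digraph.digraph_isomorphism (with_proj (dipath l)) ?f"
    using assms pair_wf_dipath_image[of l id]
    by (auto simp: pre_digraph.digraph_isomorphism_def wf_digraph_wp_iff dipath_eq_image[symmetric])
       (simp add: dipath_def)
  moreover have "with_proj (dipath_image l v) = app_iso ?f (with_proj (dipath l))"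
    by (auto simp: app_iso_def with_proj_def dipath_def dipath_image_def image_iff)
  ultimately show ?thesis unfolding digraph_iso_def by blast
qed

text \<open>A directed path has no nontrivial automorphism: only its first vertex has no incoming
  arc, and every vertex has at most one successor. Hence counting vertex sequences counts
  copies.\<close>

lemma dipath_image_eqD:
  assumes eq: "dipath_image l v = dipath_image l w"
    and v: "inj_on v {0..l}" and w: "inj_on w {0..l}" and "i \<le> l"
  shows "v i = w i"
  using \<open>i \<le> l\<close>
proof (induction i)
  case 0
  have arcs: "(\<lambda>i. (v i, v (Suc i))) ` {..<l} = (\<lambda>i. (w i, w (Suc i))) ` {..<l}"
    and verts: "v ` {0..l} = w ` {0..l}"
    using eq by (simp_all add: dipath_image_def)
  obtain j where j: "j \<le> l" "v 0 = w j" using verts by force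
  show ?case
  proof (cases j)
    case (Suc j')
    \<comment> \<open>Were \<open>v 0\<close> not first along \<open>w\<close>, an arc would enter
      it, against injectivity of \<open>v\<close>.\<close>
    with j have "(w j', v 0) \<in> (\<lambda>i. (v i, v (Suc i))) ` {..<l}"
      unfolding arcs by auto
    then obtain i where "i < l" "v 0 = v (Suc i)" by blast
    with inj_onD[OF v, of 0 "Suc i"] show ?thesis by simp
  qed (use j in simp)
next
  case (Suc i)
  have "(v i, v (Suc i)) \<in> parcs (dipath_image l v)"
    using Suc.prems by (auto simp: dipath_image_def)
  then have "(v i, v (Suc i)) \<in> (\<lambda>i. (w i, w (Suc i))) ` {..<l}"
    unfolding eq by (simp add: dipath_image_def)
  then obtain j where j: "j < l" "v i = w j" "v (Suc i) = w (Suc j)" by blast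
  then have "w i = w j" using Suc by simp
  then have "i = j" using inj_onD[OF w, of i j] Suc.prems j(1) by simp
  with j(3) show ?case by simp
qed

section \<open>Geodecity of relations and transfer to \<open>ex\<close>\<close>

lemma successively_vwalk_arcs: "set (vwalk_arcs p) \<subseteq> A \<longleftrightarrow> successively (\<lambda>x y. (x, y) \<in> A) p"
  by (induction p rule: vwalk_arcs.induct) auto

text \<open>Free of the digraph records, so that vertices may be words or pairs. A walk is its
  vertex list, so at most \<open>k\<close> arcs means length at most \<open>Suc k\<close>.\<close>

definition geodetic_rel :: "nat \<Rightarrow> 'a set \<Rightarrow> ('a \<Rightarrow> 'a \<Rightarrow> bool) \<Rightarrow> bool" where
  "geodetic_rel k V E \<longleftrightarrow>
     (\<forall>p q. set p \<subseteq> V \<and> set q \<subseteq> V \<and> p \<noteq> [] \<and> q \<noteq> [] \<and> successively E p \<and> successively E q \<and>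
            hd p = hd q \<and> last p = last q \<and> length p \<le> Suc k \<and> length q \<le> Suc k \<longrightarrow> p = q)"

lemma geodetic_relD:
  assumes "geodetic_rel k V E"
    and "set p \<subseteq> V" "p \<noteq> []" "successively E p" "length p \<le> Suc k"
    and "set q \<subseteq> V" "q \<noteq> []" "successively E q" "length q \<le> Suc k"
    and "hd p = hd q" "last p = last q"
  shows "p = q"
  by (rule assms(1)[unfolded geodetic_rel_def, rule_format]) (simp add: assms(2-))

lemma k_geodetic_iff_geodetic_rel:
  "k_geodetic k G \<longleftrightarrow> geodetic_rel k (pverts G) (\<lambda>x y. (x, y) \<in> parcs G)"
proof -
  have walk: "vwalk p (with_proj G) \<longleftrightarrow>
      set p \<subseteq> pverts G \<and> p \<noteq> [] \<and> successively (\<lambda>x y. (x, y) \<in> parcs G) p" for p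
    by (auto simp: vwalk_def successively_vwalk_arcs)
  show ?thesis
  proof
    assume k: "k_geodetic k G"
    show "geodetic_rel k (pverts G) (\<lambda>x y. (x, y) \<in> parcs G)"
      unfolding geodetic_rel_def
    proof (intro allI impI)
      fix p q
      assume pq: "set p \<subseteq> pverts G \<and> set q \<subseteq> pverts G \<and> p \<noteq> [] \<and> q \<noteq> [] \<and>
        successively (\<lambda>x y. (x, y) \<in> parcs G) p \<and> successively (\<lambda>x y. (x, y) \<in> parcs G) q \<and>
        hd p = hd q \<and> last p = last q \<and> length p \<le> Suc k \<and> length q \<le> Suc k"
      then have "vwalk p (with_proj G)" "vwalk q (with_proj G)" "hd p \<in> pverts G" "last p \<in> pverts G"
          "hd q = hd p" "last q = last p" "vwalk_length p \<le> k" "vwalk_length q \<le> k"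
        by (simp_all add: walk le_diff_conv subset_iff)
      with k show "p = q" unfolding k_geodetic_def by blast
    qed
  next
    assume rel: "geodetic_rel k (pverts G) (\<lambda>x y. (x, y) \<in> parcs G)"
    show "k_geodetic k G"
      unfolding k_geodetic_def
    proof (intro ballI allI impI, elim conjE)
      fix u v p q
      assume "vwalk p (with_proj G)" "vwalk q (with_proj G)"
        "hd p = u" "hd q = u" "last p = v" "last q = v" "vwalk_length p \<le> k" "vwalk_length q \<le> k"
      then show "p = q"
        by (intro geodetic_relD[OF rel]) (simp_all add: walk le_diff_conv)
    qed
  qed
qed

text \<open>Walks are pulled back along the inverse of \<open>f\<close>. Vertices of
  \<open>U\<close> outside the image of \<open>V\<close> are isolated and carry only trivial
  walks.\<close>

lemma geodetic_rel_image:
  assumes geo: "geodetic_rel k V E" and f: "inj_on f V" "f ` V \<subseteq> U"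
    and E: "\<And>x y. E x y \<Longrightarrow> x \<in> V \<and> y \<in> V"
  shows "geodetic_rel k U (\<lambda>x y. (x, y) \<in> map_prod f f ` {(x, y). E x y})"
    (is "geodetic_rel k U ?R")
proof -
  let ?g = "inv_into V f"
  have R: "x \<in> f ` V \<and> y \<in> f ` V \<and> E (?g x) (?g y)" if "?R x y" for x y
    using that E f(1) by (auto simp: inv_into_f_f)
  have single: "p = [hd p]" if "p \<noteq> []" "length p \<le> 1" for p :: "'b list"
    using that by (cases p) auto
  have img: "set p \<subseteq> f ` V" if "successively ?R p" "length p \<ge> 2" for p
    using that
  proof (induction p rule: induct_list012)
    case (3 x y zs)
    then show ?case using R by (cases zs) auto
  qed auto
  show ?thesis
    unfolding geodetic_rel_def
  proof (intro allI impI, elim conjE)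
    fix p q
    assume p: "successively ?R p" "p \<noteq> []" "length p \<le> Suc k"
      and q: "successively ?R q" "q \<noteq> []" "length q \<le> Suc k"
      and ends: "hd p = hd q" "last p = last q"
    show "p = q"
    proof (cases "length p \<le> 1 \<and> length q \<le> 1")
      case True
      with single[of p] single[of q] p q ends show ?thesis by simp
    next
      case False
      \<comment> \<open>One of the two walks has an arc and so lies in the image of
        \<open>V\<close>; the shared first vertex keeps the other one there too.\<close>
      have hds: "hd p \<in> f ` V"
      proof (cases "length p \<le> 1")
        case True
        then have "set q \<subseteq> f ` V" using \<open>\<not> (length p \<le> 1 \<and> length q \<le> 1)\<close> img[of q] q by simp
        then show ?thesis using q ends by auto
      next
        case False
        then have "set p \<subseteq> f ` V" using img[of p] p by simp
        then show ?thesis using p by auto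
      qed
      have sets: "set p \<subseteq> f ` V" "set q \<subseteq> f ` V"
        using hds ends img[of p] img[of q] single[of p] single[of q] p q
        by (metis (no_types) One_nat_def Suc_1 not_less_eq_eq empty_subsetI insert_subset list.set)+
      have "successively E (map ?g p)" "successively E (map ?g q)"
        using p q R by (auto simp: successively_map intro: successively_mono)
      moreover have "set (map ?g p) \<subseteq> V" "set (map ?g q) \<subseteq> V"
        using sets by (auto simp: inv_into_into)
      ultimately have "map ?g p = map ?g q"
        using p q ends by (intro geodetic_relD[OF geo]) (simp_all add: hd_map last_map)
      moreover have "inj_on ?g (set p \<union> set q)"
        using sets by (intro inj_on_inv_into) auto
      ultimately show ?thesis
        by (rule map_inj_on)
    qed
  qed
qed

lemma card_le_ex_dipath:
  fixes v :: "'c \<Rightarrow> nat \<Rightarrow> 'a"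
  assumes fin: "finite V" and card: "card V \<le> n"
    and E: "\<And>x y. E x y \<Longrightarrow> x \<in> V \<and> y \<in> V \<and> x \<noteq> y"
    and geo: "geodetic_rel k V E"
    and paths: "\<And>w. w \<in> W \<Longrightarrow> inj_on (v w) {0..l}"
      "\<And>w i. w \<in> W \<Longrightarrow> i \<le> l \<Longrightarrow> v w i \<in> V"
      "\<And>w i. w \<in> W \<Longrightarrow> i < l \<Longrightarrow> E (v w i) (v w (Suc i))"
    and inj: "\<And>w w'. w \<in> W \<Longrightarrow> w' \<in> W \<Longrightarrow> (\<And>i. i \<le> l \<Longrightarrow> v w i = v w' i) \<Longrightarrow> w = w'"
  shows "card W \<le> ex n (dipath l) k"
proof -
  obtain f :: "'a \<Rightarrow> nat" where f: "inj_on f V" "f ` V \<subseteq> {..<n}"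
    using card_le_inj[OF fin, of "{..<n}"] card by auto
  let ?G = "\<lparr> pverts = {..<n}, parcs = map_prod f f ` {(x, y). E x y} \<rparr>"
  have ends: "f x < n" if "x \<in> V" for x
    using f that by auto
  have E_image: "fst e < n" "snd e < n" "fst e \<noteq> snd e" if "e \<in> map_prod f f ` {(x, y). E x y}" for e
    using that E ends inj_on_eq_iff[OF f(1)] by auto
  have G: "pair_digraph ?G"
  proof unfold_locales
    have "map_prod f f ` {(x, y). E x y} \<subseteq> {..<n} \<times> {..<n}"
      using E_image by (intro subsetI) (simp add: mem_Times_iff)
    then show "finite (parcs ?G)"
      by (simp add: finite_subset)
  qed (simp_all add: E_image)
  have kgeo: "k_geodetic k ?G"
    unfolding k_geodetic_iff_geodetic_rel using geodetic_rel_image[OF geo f] E by simp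
  let ?H = "\<lambda>w. dipath_image l (f \<circ> v w)"
  have inj_fv: "inj_on (f \<circ> v w) {0..l}" if "w \<in> W" for w
    using paths(1,2)[OF that] f(1) by (intro comp_inj_on inj_on_subset[OF f(1)]) auto
  have "?H w \<in> copies (dipath l) ?G" if "w \<in> W" for w
  proof -
    have "subgraph (with_proj (?H w)) (with_proj ?G)"
      using G pair_wf_dipath_image[of l "f \<circ> v w"] paths(2,3)[OF that] ends
      by (auto simp: subgraph_def compatible_def wf_digraph_wp_iff dipath_image_def
            pair_digraph.pair_wf_digraph intro!: image_eqI)
    then show ?thesis
      unfolding copies_def using digraph_iso_dipath_image[OF inj_fv[OF that]] by blast
  qed
  moreover have "inj_on ?H W"
  proof (rule inj_onI)
    fix w w' assume w: "w \<in> W" "w' \<in> W" and eq: "?H w = ?H w'"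
    show "w = w'"
    proof (rule inj[OF w])
      fix i assume i: "i \<le> l"
      with dipath_image_eqD[OF eq inj_fv[OF w(1)] inj_fv[OF w(2)] i] paths(2)[OF w(1) i] paths(2)[OF w(2) i]
        inj_on_eq_iff[OF f(1)]
      show "v w i = v w' i" by simp
    qed
  qed
  ultimately have "card W \<le> card (copies (dipath l) ?G)"
    by (intro card_inj_on_le copies_bounded(1)[OF G]) auto
  also have "\<dots> \<le> ex n (dipath l) k"
    unfolding ex_def using G kgeo
    by (intro Max_ge[OF finite_copy_counts]) (auto simp: copy_counts_def)
  finally show ?thesis .
qed

text \<open>The count is a falling factorial with \<open>M\<close> factors, each at least
  \<open>N - M\<close>. For \<open>N < M\<close> truncated subtraction makes the bound
  \<open>0\<close>.\<close>

lemma card_distinct_words_ge: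
  assumes "0 < M"
  shows "(N - M) ^ M \<le> card {w :: nat list. length w = M \<and> distinct w \<and> set w \<subseteq> {..<N}}"
proof (cases "M \<le> N")
  case True
  have "(N - M) ^ M \<le> (\<Prod>i\<in>{N - M + 1..N}. i)"
    using prod_mono[of "{N - M + 1..N}" "\<lambda>_. N - M" "\<lambda>i. i"] True by simp
  then show ?thesis
    using card_lists_distinct_length_eq[of "{..<N}" M] True by simp
next
  case False
  then have "(N - M) ^ M = 0" using assms by (simp add: power_0_left)
  then show ?thesis by (simp only: le0)
qed

section \<open>Permutation digraphs\<close>

definition perm_words :: "nat \<Rightarrow> nat \<Rightarrow> nat list set" where
  "perm_words N k = {w. length w = k \<and> distinct w \<and> set w \<subseteq> {..<N}}"

text \<open>The new letter avoids even the deleted one; otherwise rotating a word \<open>k\<close>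
  times would be a closed walk of length \<open>k\<close> beside the trivial one.\<close>

definition perm_arc :: "nat \<Rightarrow> nat \<Rightarrow> nat list \<Rightarrow> nat list \<Rightarrow> bool" where
  "perm_arc N k u v \<longleftrightarrow> u \<in> perm_words N k \<and> v \<in> perm_words N k \<and>
     (\<forall>j. Suc j < k \<longrightarrow> v ! j = u ! Suc j) \<and> v ! (k - 1) \<notin> set u"

lemma finite_perm_words: "finite (perm_words N k)"
  and card_perm_words_le: "card (perm_words N k) \<le> N ^ k"
proof -
  have eq: "{w. set w \<subseteq> {..<N} \<and> length w = k} \<supseteq> perm_words N k"
    by (auto simp: perm_words_def)
  show "finite (perm_words N k)"
    using eq by (rule finite_subset) (simp add: finite_lists_length_eq)
  show "card (perm_words N k) \<le> N ^ k"
    using card_mono[OF _ eq] by (simp add: finite_lists_length_eq card_lists_length_eq)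
qed

text \<open>Each arc moves the surviving letters one place to the left.\<close>

lemma perm_walk_shift:
  assumes "successively (perm_arc N k) p" "i + s < length p" "j + s < k"
  shows "p ! (i + s) ! j = p ! i ! (j + s)"
  using assms(2,3)
proof (induction s arbitrary: j)
  case (Suc s)
  then have "perm_arc N k (p ! (i + s)) (p ! Suc (i + s))"
    using assms(1) by (simp add: successively_conv_nth)
  then have "p ! Suc (i + s) ! j = p ! (i + s) ! Suc j"
    using Suc.prems by (simp add: perm_arc_def)
  with Suc.IH[of "Suc j"] Suc.prems show ?case by simp
qed simp

lemma geodetic_rel_perm_arc:
  assumes "0 < k"
  shows "geodetic_rel k (perm_words N k) (perm_arc N k)"
  unfolding geodetic_rel_def
proof (intro allI impI, elim conjE)
  fix p q
  assume p: "successively (perm_arc N k) p" "p \<noteq> []" "length p \<le> Suc k" "set p \<subseteq> perm_words N k"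
    and q: "successively (perm_arc N k) q" "q \<noteq> []" "length q \<le> Suc k" "set q \<subseteq> perm_words N k"
    and ends: "hd p = hd q" "last p = last q"
  have hd_word: "distinct (hd p)" "length (hd p) = k"
    using subsetD[OF p(4) hd_in_set[OF p(2)]] by (auto simp: perm_words_def)
  \<comment> \<open>With fewer than \<open>k\<close> arcs, the first letter of the last word
    survives from the first word, where its index is the number of arcs.\<close>
  have start: "last r ! 0 = hd r ! (length r - 1)"
    if "successively (perm_arc N k) r" "r \<noteq> []" "length r \<le> k" for r
    using perm_walk_shift[OF that(1), of 0 "length r - 1" 0] that(2,3) \<open>0 < k\<close>
    by (cases r) (auto simp: hd_conv_nth last_conv_nth)
  \<comment> \<open>With exactly \<open>k\<close> arcs, that letter was appended by the first arc,
    hence is new.\<close>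
  have start': "last r ! 0 \<notin> set (hd r)"
    if r: "successively (perm_arc N k) r" "length r = Suc k" for r
  proof -
    have "r ! k ! 0 = r ! 1 ! (k - 1)"
      using perm_walk_shift[OF r(1), of 1 "k - 1" 0] r(2) \<open>0 < k\<close> by simp
    moreover have "perm_arc N k (r ! 0) (r ! 1)"
      using r \<open>0 < k\<close> by (simp add: successively_conv_nth)
    moreover have "r \<noteq> []" using r by auto
    ultimately show ?thesis
      using r(2) by (simp add: hd_conv_nth last_conv_nth perm_arc_def)
  qed
  \<comment> \<open>These two facts separate walks with \<open>k\<close> arcs from shorter ones; for
    two shorter walks, distinctness of the letters makes the index unique.\<close>
  have len: "length p = length q"
  proof -
    have False if "successively (perm_arc N k) r" "r \<noteq> []" "length r \<le> k"
      "successively (perm_arc N k) s" "length s = Suc k"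
      "hd r = hd p" "hd s = hd p" "last r = last s" for r s
      using start[OF that(1-3)] start'[OF that(4,5)] that(2,3,6-8) hd_word \<open>0 < k\<close>
      by (cases r) (auto dest!: nth_mem)
    moreover have "length p = length q" if "length p \<le> k" "length q \<le> k"
    proof -
      have "hd p ! (length p - 1) = hd p ! (length q - 1)"
        using start[OF p(1,2) that(1)] start[OF q(1,2) that(2)] ends by simp
      then have "length p - 1 = length q - 1"
        using hd_word that \<open>0 < k\<close> by (subst (asm) nth_eq_iff_index_eq) auto
      then show ?thesis using p(2) q(2) by (cases p; cases q) auto
    qed
    ultimately show ?thesis
      using p q ends by (metis le_Suc_eq)
  qed
  show "p = q"
  proof (rule nth_equalityI[OF len])
    fix i assume i: "i < length p"
    have words: "p ! i \<in> perm_words N k" "q ! i \<in> perm_words N k"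
      using i len p(4) q(4) by auto
    show "p ! i = q ! i"
    proof (rule nth_equalityI)
      fix j assume "j < length (p ! i)"
      then have j: "j < k" using words by (simp add: perm_words_def)
      \<comment> \<open>As the walk has at most \<open>k\<close> arcs, each letter on the way comes from the first word or survives into the last.\<close>
      show "p ! i ! j = q ! i ! j"
      proof (cases "i + j < k")
        case True
        then show ?thesis
          using perm_walk_shift[OF p(1), of 0 i j] perm_walk_shift[OF q(1), of 0 i j] i len ends p q
          by (simp add: hd_conv_nth add.commute)
      next
        case False
        \<comment> \<open>\<open>s\<close> arcs remain after word \<open>i\<close>; as
          \<open>k \<le> i + j\<close> and there are at most \<open>k\<close> arcs,
          \<open>s \<le> j\<close>.\<close>
        define s where "s = length p - 1 - i"
        have s: "s \<le> j" "i + s = length p - 1" "i + s < length p"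
          using False i p(3) by (auto simp: s_def)
        show ?thesis
          using perm_walk_shift[OF p(1), of i s "j - s"] perm_walk_shift[OF q(1), of i s "j - s"]
            s j len ends p q
          by (simp add: last_conv_nth)
      qed
    qed (use words in \<open>simp add: perm_words_def\<close>)
  qed
qed

text \<open>The path of a word of \<open>k + l\<close> distinct letters consists of its
  \<open>l + 1\<close> windows of length \<open>k\<close>.\<close>

lemma ex_ge_perm_words:
  assumes k: "2 \<le> k" and N: "N ^ k \<le> n"
  shows "(N - (k + l)) ^ (k + l) \<le> ex n (dipath l) k"
proof -
  have "card (perm_words N (k + l)) \<le> ex n (dipath l) k"
  proof (rule card_le_ex_dipath[where V = "perm_words N k" and E = "perm_arc N k"
        and v = "\<lambda>w i. take k (drop i w)"])
    show "card (perm_words N k) \<le> n"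
      using card_perm_words_le N by (rule order_trans)
  next
    fix x y assume E: "perm_arc N k x y"
    moreover have "x \<noteq> y"
    proof
      assume "x = y"
      with E have "x ! (k - 1) \<notin> set x" "length x = k"
        by (auto simp: perm_arc_def perm_words_def)
      with k nth_mem[of "k - 1" x] show False by simp
    qed
    ultimately show "x \<in> perm_words N k \<and> y \<in> perm_words N k \<and> x \<noteq> y"
      by (simp add: perm_arc_def)
  next
    fix w assume w: "w \<in> perm_words N (k + l)"
    show "inj_on (\<lambda>i. take k (drop i w)) {0..l}"
    proof (rule inj_onI)
      fix i j assume ij: "i \<in> {0..l}" "j \<in> {0..l}" "take k (drop i w) = take k (drop j w)"
      \<comment> \<open>Windows are told apart by their first letters.\<close>
      have "take k (drop i w) ! 0 = w ! i" if "i \<le> l" for i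
        using that k w by (simp add: perm_words_def)
      from this[of i] this[of j] ij have "w ! i = w ! j" by simp
      then show "i = j" using k ij w by (simp add: perm_words_def nth_eq_iff_index_eq)
    qed
    show V: "take k (drop i w) \<in> perm_words N k" if "i \<le> l" for i
      using w that set_take_subset[of k "drop i w"] set_drop_subset[of i w]
      by (auto simp: perm_words_def)
    show "perm_arc N k (take k (drop i w)) (take k (drop (Suc i) w))" if i: "i < l" for i
    proof -
      have "w ! (i + j) \<noteq> w ! (i + k)" if "j < k" for j
        using w i that by (simp add: perm_words_def nth_eq_iff_index_eq)
      then have "w ! (i + k) \<notin> set (take k (drop i w))"
        using w i by (auto simp: perm_words_def in_set_conv_nth)
      then show ?thesis
        using V[of i] V[of "Suc i"] i k w by (auto simp: perm_arc_def perm_words_def)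
    qed
  next
    fix w w'
    assume w: "w \<in> perm_words N (k + l)" "w' \<in> perm_words N (k + l)"
      and eq: "\<And>i. i \<le> l \<Longrightarrow> take k (drop i w) = take k (drop i w')"
    show "w = w'"
    proof (rule nth_equalityI)
      fix j assume "j < length w"
      then have j: "j < k + l" using w by (simp add: perm_words_def)
      \<comment> \<open>Position \<open>j\<close> lies in the window starting at
        \<open>min j l\<close>, with offset below \<open>k\<close> because
        \<open>j < k + l\<close>.\<close>
      have "take k (drop (min j l) w) ! (j - min j l) = take k (drop (min j l) w') ! (j - min j l)"
        using eq[of "min j l"] by simp
      then show "w ! j = w' ! j"
        using j k w by (simp add: perm_words_def)
    qed (use w in \<open>simp add: perm_words_def\<close>)
  qed (use k in \<open>auto simp: finite_perm_words geodetic_rel_perm_arc\<close>)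
  moreover have "(N - (k + l)) ^ (k + l) \<le> card (perm_words N (k + l))"
    unfolding perm_words_def using k by (intro card_distinct_words_ge) simp
  ultimately show ?thesis by linarith
qed

section \<open>The matched bipartite digraph for odd length\<close>

text \<open>The boolean component marks the primed copy: an arc into it changes the number, an arc out of it
  keeps the number.\<close>

definition matched_arc :: "nat \<Rightarrow> nat \<times> bool \<Rightarrow> nat \<times> bool \<Rightarrow> bool" where
  "matched_arc m x y \<longleftrightarrow> fst x < m \<and> fst y < m \<and> snd y = (\<not> snd x) \<and> (snd x \<longleftrightarrow> fst x = fst y)"

text \<open>Arcs alternate between the two copies, so walks with the same ends have lengths of equal
  parity. In a walk of length 2 the matching fixes the middle vertex, and the other arc changes the
  number, so the walk is not closed.\<close>

lemma geodetic_rel_matched_arc: "geodetic_rel 2 V (matched_arc m)"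
proof -
  have short: "(\<exists>a. p = [a]) \<or> (\<exists>a b. p = [a, b]) \<or> (\<exists>a b c. p = [a, b, c])"
    if "p \<noteq> []" "length p \<le> 3" for p :: "(nat \<times> bool) list"
    using that by (auto simp: length_Suc_conv le_Suc_eq numeral_3_eq_3)
  show ?thesis
    unfolding geodetic_rel_def
  proof (intro allI impI, elim conjE)
    fix p q
    assume p: "successively (matched_arc m) p" "p \<noteq> []" "length p \<le> Suc 2"
      and q: "successively (matched_arc m) q" "q \<noteq> []" "length q \<le> Suc 2"
      and ends: "hd p = hd q" "last p = last q"
    show "p = q"
      by (insert short[of p] short[of q] p q ends, simp, elim disjE exE)
         (auto simp: matched_arc_def prod_eq_iff)
  qed
qed

text \<open>Of the \<open>2 * t + 1\<close> arcs, the \<open>t + 1\<close> leaving even positions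
  change the letter, so a path uses \<open>t + 2\<close> letters.\<close>

lemma ex_ge_matched:
  assumes "2 * m \<le> n"
  shows "(m - (t + 2)) ^ (t + 2) \<le> ex n (dipath (2 * t + 1)) 2"
proof -
  have "card (perm_words m (t + 2)) \<le> ex n (dipath (2 * t + 1)) 2"
  proof (rule card_le_ex_dipath[where V = "{..<m} \<times> UNIV" and E = "matched_arc m"
        and v = "\<lambda>w i. (w ! (Suc i div 2), odd i)"])
    fix w assume w: "w \<in> perm_words m (t + 2)"
    have less: "Suc i div 2 < t + 2" if "i \<le> 2 * t + 1" for i
      using that by linarith
    have mem: "w ! (Suc i div 2) < m" if "i \<le> 2 * t + 1" for i
    proof -
      have "w ! (Suc i div 2) \<in> set w"
        using less[OF that] w by (intro nth_mem) (simp add: perm_words_def)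
      with w show ?thesis by (auto simp: perm_words_def)
    qed
    have eq: "w ! i = w ! j \<longleftrightarrow> i = j" if "i < t + 2" "j < t + 2" for i j
      using w that by (simp add: perm_words_def nth_eq_iff_index_eq)
    show "inj_on (\<lambda>i. (w ! (Suc i div 2), odd i)) {0..2 * t + 1}"
    proof (rule inj_onI)
      fix i j
      assume "i \<in> {0..2 * t + 1}" "j \<in> {0..2 * t + 1}"
        "(w ! (Suc i div 2), odd i) = (w ! (Suc j div 2), odd j)"
      then have "Suc i div 2 = Suc j div 2" "odd i = odd j"
        using eq less by auto
      then show "i = j" by presburger
    qed
    show "(w ! (Suc i div 2), odd i) \<in> {..<m} \<times> UNIV" if "i \<le> 2 * t + 1" for i
      using mem[OF that] by simp
    show "matched_arc m (w ! (Suc i div 2), odd i) (w ! (Suc (Suc i) div 2), odd (Suc i))"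
      if i: "i < 2 * t + 1" for i
    proof -
      have "w ! (Suc i div 2) = w ! (Suc (Suc i) div 2) \<longleftrightarrow> Suc i div 2 = Suc (Suc i) div 2"
        using i less by (intro eq) auto
      also have "\<dots> \<longleftrightarrow> odd i" by presburger
      finally show ?thesis
        using mem[of i] mem[of "Suc i"] i by (simp add: matched_arc_def)
    qed
  next
    fix w w'
    assume w: "w \<in> perm_words m (t + 2)" "w' \<in> perm_words m (t + 2)"
      and eq: "\<And>i. i \<le> 2 * t + 1 \<Longrightarrow>
        (w ! (Suc i div 2), odd i) = (w' ! (Suc i div 2), odd i)"
    show "w = w'"
    proof (rule nth_equalityI)
      fix j assume "j < length w"
      then have "j < t + 2" using w by (simp add: perm_words_def)
      \<comment> \<open>Letter \<open>j\<close> is read at position \<open>2 * j - 1\<close>; for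
        \<open>j = 0\<close> truncation gives position \<open>0\<close>, which shows letter
        \<open>0\<close>.\<close>
      then show "w ! j = w' ! j"
        using eq[of "2 * j - 1"] by (cases j) auto
    qed (use w in \<open>simp add: perm_words_def\<close>)
  qed (use assms in \<open>auto simp: geodetic_rel_matched_arc card_cartesian_product matched_arc_def\<close>)
  moreover have "(m - (t + 2)) ^ (t + 2) \<le> card (perm_words m (t + 2))"
    unfolding perm_words_def by (intro card_distinct_words_ge) simp
  ultimately show ?thesis by linarith
qed

section \<open>Error terms\<close>

text \<open>For \<open>c < r\<close> this is Bernoulli's inequality for
  \<open>(1 - c / r) ^ M\<close>, scaled by \<open>r ^ M\<close>; otherwise the left side is at most
  \<open>0\<close>. The number \<open>a\<close> stands for a truncated difference.\<close>

lemma truncated_power_ge: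
  fixes r c :: real
  assumes "0 \<le> r" "0 \<le> c" "r - c \<le> real a" "0 < M"
  shows "r ^ M - real M * c * r ^ (M - 1) \<le> real (a ^ M)"
proof -
  have rM: "r ^ M = r * r ^ (M - 1)" using \<open>0 < M\<close> by (cases M) auto
  show ?thesis
  proof (cases "c < r")
    case True
    have "r ^ M - real M * c * r ^ (M - 1) = r ^ M * (1 + real M * (- c / r))"
      using True \<open>0 \<le> c\<close> by (simp add: rM field_simps)
    also have "\<dots> \<le> r ^ M * (1 + - c / r) ^ M"
      using True assms by (intro mult_left_mono Bernoulli_inequality) (auto simp: field_simps)
    also have "\<dots> = (r - c) ^ M"
      using True \<open>0 \<le> c\<close> by (simp add: power_mult_distrib[symmetric] field_simps)
    also have "\<dots> \<le> real a ^ M"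
      using True assms by (intro power_mono) auto
    finally show ?thesis by simp
  next
    case False
    have "r * r ^ (M - 1) \<le> (real M * c) * r ^ (M - 1)"
      using False assms mult_mono[of 1 "real M" r c] by (intro mult_right_mono) auto
    moreover have "0 \<le> real (a ^ M)" by simp
    ultimately show ?thesis by (simp only: rM)
  qed
qed

text \<open>Rounding \<open>r\<close> down to \<open>N\<close> loses at most 1, so
  \<open>N - (k + l)\<close> is at least \<open>r - (k + l + 1)\<close>; with the exponent
  \<open>k + l\<close> this yields the constant.\<close>

lemma ex_dipath_ge_powr:
  assumes k: "2 \<le> k" and dvd: "k dvd l"
  shows "real n ^ (l div k + 1) - (real (k + l) * real (k + l + 1)) *
           real n powr (1 + (real l - 1) / real k) \<le> real (ex n (dipath l) k)"
\<comment> \<open>For \<open>n = 0\<close> both powers vanish, as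
  \<open>0 powr x = 0\<close>.\<close>
proof (cases "n = 0")
  case False
  define r where "r = real n powr (1 / real k)"
  define N where "N = nat \<lfloor>r\<rfloor>"
  have r: "r > 0" and rp: "r ^ j = real n powr (real j / real k)" for j
    using False by (simp_all add: r_def powr_powr flip: powr_realpow)
  have N: "real N \<le> r" "r \<le> real N + 1" using r by (auto simp: N_def)
  have "real (N ^ k) \<le> r ^ k" using N r by (simp add: power_mono)
  also have "r ^ k = real n" using k False by (simp add: rp)
  finally have Nk: "N ^ k \<le> n" by simp
  have "r ^ (k + l) - real (k + l) * real (k + l + 1) * r ^ (k + l - 1)
      \<le> real ((N - (k + l)) ^ (k + l))"
    using N r k by (intro truncated_power_ge) auto
  also have "\<dots> \<le> real (ex n (dipath l) k)"
    using ex_ge_perm_words[OF k Nk] by (rule of_nat_mono)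
  finally have "r ^ (k + l) - real (k + l) * real (k + l + 1) * r ^ (k + l - 1)
      \<le> real (ex n (dipath l) k)" .
  moreover have "r ^ (k + l) = real n ^ (l div k + 1)"
  proof -
    have "k + l = k * (l div k + 1)" using dvd by simp
    then show ?thesis using \<open>r ^ k = real n\<close> by (metis power_mult)
  qed
  moreover have "r ^ (k + l - 1) = real n powr (1 + (real l - 1) / real k)"
    using k unfolding rp by (simp add: of_nat_diff field_simps)
  ultimately show ?thesis by simp
qed simp

text \<open>Since \<open>n div 2\<close> is at least \<open>n / 2 - 1\<close>, the loss
  \<open>c = t + 3\<close> covers both the rounding and the subtracted \<open>t + 2\<close>.\<close>

lemma ex_dipath_odd_ge:
  "(real n / 2) ^ (t + 2) - real (t + 2) * real (t + 3) * (real n / 2) ^ (t + 1)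
     \<le> real (ex n (dipath (2 * t + 1)) 2)"
proof -
  have "(real n / 2) ^ (t + 2) - real (t + 2) * real (t + 3) * (real n / 2) ^ (t + 2 - 1)
      \<le> real ((n div 2 - (t + 2)) ^ (t + 2))"
    by (rule truncated_power_ge) linarith+
  also have "\<dots> \<le> real (ex n (dipath (2 * t + 1)) 2)"
    by (intro of_nat_mono ex_ge_matched) simp
  finally show ?thesis by simp
qed

text \<open>The odd case carries an error term: for \<open>n = l = 1\<close> there is no arc, yet
  \<open>(n / 2) ^ 2\<close> is positive. The even case is \<open>k = 2\<close> of the
  first.\<close>

theorem theorem30:
  shows "(\<forall>k l :: nat. k \<ge> 2 \<and> k dvd l \<longrightarrow>
            (\<exists>h :: nat \<Rightarrow> real. h \<in> O(\<lambda>n. real n powr (1 + (real l - 1) / real k)) \<and>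
               (\<forall>n. real (ex n (dipath l) k) \<ge> real n ^ (l div k + 1) + h n))) \<and>
         (\<forall>l :: nat. even l \<longrightarrow>
            (\<exists>h :: nat \<Rightarrow> real. h \<in> O(\<lambda>n. real n powr ((real l + 1) / 2)) \<and>
               (\<forall>n. real (ex n (dipath l) 2) \<ge> real n ^ (l div 2 + 1) + h n))) \<and>
         (\<forall>l :: nat. odd l \<longrightarrow>
            (\<exists>h :: nat \<Rightarrow> real. h \<in> O(\<lambda>n. real n ^ ((l + 1) div 2)) \<and>
               (\<forall>n. real (ex n (dipath l) 2) \<ge> (real n / 2) ^ ((l + 3) div 2) + h n)))"
proof (intro conjI allI impI)
  have main: "\<exists>h :: nat \<Rightarrow> real. h \<in> O(\<lambda>n. real n powr (1 + (real l - 1) / real k)) \<and>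
      (\<forall>n. real (ex n (dipath l) k) \<ge> real n ^ (l div k + 1) + h n)"
    if "2 \<le> k" "k dvd l" for k l :: nat
  proof -
    let ?h = "\<lambda>n. - (real (k + l) * real (k + l + 1)) * real n powr (1 + (real l - 1) / real k)"
    have "?h \<in> O(\<lambda>n. real n powr (1 + (real l - 1) / real k))" by simp
    moreover have "\<forall>n. real n ^ (l div k + 1) + ?h n \<le> real (ex n (dipath l) k)"
      using ex_dipath_ge_powr[OF that] by simp
    ultimately show ?thesis by blast
  qed
  show "\<exists>h :: nat \<Rightarrow> real. h \<in> O(\<lambda>n. real n powr (1 + (real l - 1) / real k)) \<and>
      (\<forall>n. real (ex n (dipath l) k) \<ge> real n ^ (l div k + 1) + h n)"
    if "2 \<le> k \<and> k dvd l" for k l :: nat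
    using that main by blast
  show "\<exists>h :: nat \<Rightarrow> real. h \<in> O(\<lambda>n. real n powr ((real l + 1) / 2)) \<and>
      (\<forall>n. real (ex n (dipath l) 2) \<ge> real n ^ (l div 2 + 1) + h n)"
    if "even l" for l :: nat
  proof -
    have "1 + (real l - 1) / real 2 = (real l + 1) / 2" by (simp add: field_simps)
    then show ?thesis
      using main[of 2 l, OF order_refl that] by (simp only:)
  qed
  show "\<exists>h :: nat \<Rightarrow> real. h \<in> O(\<lambda>n. real n ^ ((l + 1) div 2)) \<and>
      (\<forall>n. real (ex n (dipath l) 2) \<ge> (real n / 2) ^ ((l + 3) div 2) + h n)"
    if "odd l" for l :: nat
  proof -
    obtain t where l: "l = 2 * t + 1" using \<open>odd l\<close> by (rule oddE)
    then have exps: "(l + 1) div 2 = t + 1" "(l + 3) div 2 = t + 2" by auto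
    let ?h = "\<lambda>n. - (real (t + 2) * real (t + 3)) * (real n / 2) ^ (t + 1)"
    have "?h \<in> O(\<lambda>n. real n ^ (t + 1))" by (simp add: power_divide)
    moreover have "\<forall>n. (real n / 2) ^ (t + 2) + ?h n \<le> real (ex n (dipath l) 2)"
      using ex_dipath_odd_ge[of _ t] by (simp add: l)
    ultimately show ?thesis unfolding exps by blast
  qed
qed

end
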